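(* Let $\epsilon>0$ and $M>0$ be real numbers. Then there are infinitely many positive integers $n$, each together with a subset $J\subset\mathbb{Z}_n$ and an integer $d$, such that $$D_{\mathbb{Z}_n}(J,N)\le (n-d)^N$$ holds for all positive integers $N$, and such that: (i) $n$ has at least $M$ distinct prime divisors and the smallest prime divisor of $n$ is at least $M$; (ii) $J\cap(-J)=\{0\}$, $|J|\ge n^{\epsilon/3}$, and $J$ generates $\mathbb{Z}_n$; (iii) $d\ge \frac18 n^{1-\epsilon/3}$ and $d\ge n^{1-\epsilon}|J|$; (iv) for each $a\in J\setminus\{0\}$, the subgroup $H$ of $\mathbb{Z}_n$ generated by $a$ has index $[\mathbb{Z}_n:H]\le d-\frac{1}{24}n^{1-\epsilon/3}$.
   Context: For a finite abelian group $G$ (written additively), a subset $J\subset G$ with $0\in J$, and a positive integer $N$, $D_G(J,N)$ denotes the maximum size of a set $A\subset G^N$ such that $(A-A)\cap J^N=\{\mathbf{0}\}$, where $G^N,J^N$ are $N$-fold Cartesian products. $\mathbb{Z}_n$ is the cyclic group of order $n$.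
   Formalization: The formal theorem assumes ε < 3; for ε ≥ 3 the claim is false, since (i) forces n ≥ 2 and (ii) would need |J| ≥ n^{ε/3} ≥ n, while J∩(−J)={0} gives |J| ≤ (n+1)/2 < n. *)

theory Defs
  imports
    "HOL-Algebra.Product_Groups"
    "HOL-Algebra.Elementary_Groups"
    "HOL-Computational_Algebra.Primes"
    Complex_Main
begin

text \<open>
  Abelian groups are HOL-Algebra groups written multiplicatively: the difference set \<open>A - A\<close>
  is \<open>A <#> set_inv A\<close> and \<open>-J\<close> is \<open>set_inv J\<close>.
\<close>

abbreviation power_group :: "('a, 'b) monoid_scheme \<Rightarrow> nat \<Rightarrow> (nat \<Rightarrow> 'a) monoid" where
  "power_group G N \<equiv> product_group {..<N} (\<lambda>_. G)"

definition difference_avoiding :: "('a, 'b) monoid_scheme \<Rightarrow> 'a set \<Rightarrow> nat \<Rightarrow> (nat \<Rightarrow> 'a) set \<Rightarrow> bool" where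
  "difference_avoiding G J N A \<longleftrightarrow>
     A \<subseteq> carrier (power_group G N) \<and>
     (A <#>\<^bsub>power_group G N\<^esub> set_inv\<^bsub>power_group G N\<^esub> A) \<inter> ({..<N} \<rightarrow>\<^sub>E J) = {\<one>\<^bsub>power_group G N\<^esub>}"

text \<open>
  Meaningful for finite \<open>G\<close> and \<open>\<one> \<in> J\<close>: then the set of sizes is finite, and
  it is nonempty because every singleton is admissible.
\<close>

definition D :: "('a, 'b) monoid_scheme \<Rightarrow> 'a set \<Rightarrow> nat \<Rightarrow> nat" where
  "D G J N = Max {card A | A. difference_avoiding G J N A}"

text \<open>
  Intended for a subgroup \<open>H\<close> of a finite group \<open>G\<close>.
\<close>

definition subgroup_index :: "('a, 'b) monoid_scheme \<Rightarrow> 'a set \<Rightarrow> nat" where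
  "subgroup_index G H = card (rcosets\<^bsub>G\<^esub> H)"

end

theory Submission
  imports Defs "HOL-Computational_Algebra.Polynomial" "HOL-Number_Theory.Cong"
    "HOL-Algebra.Multiplicative_Group"
begin

text \<open>
  If \<open>f\<close> is supported on \<open>J\<close> with \<open>f 0 \<noteq> 0\<close> and the matrix \<open>f (x - y)\<close> has rank at most \<open>r\<close>,
  then its \<open>N\<close>-th tensor power is diagonal with nonzero diagonal on every difference-avoiding
  set, which therefore has at most \<open>r\<^sup>N\<close> elements. On \<open>\<int>\<^sub>m\<close> with \<open>\<omega> = e\<^bsup>2\<pi>i/m\<^esup>\<close>, the
  function \<open>f x = (\<Prod>t<j<m. \<omega>\<^sup>x - \<omega>\<^sup>j)\<close> is supported on \<open>{0..t}\<close>, and expanding it as a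
  polynomial in \<open>\<omega>\<^sup>x\<close> with \<open>m - t\<close> coefficients gives rank at most \<open>m - t\<close>.

  Take \<open>n = p m\<close> with \<open>p = 2 t + 1\<close> a large prime, \<open>m = Q\<^sup>k\<close> a power of a fixed product of many
  large primes, and \<open>J = {0..t} \<times> {0, 1}\<close> under \<open>\<int>\<^sub>n = \<int>\<^sub>p \<times> \<int>\<^sub>m\<close>. The tensor product of the two
  kernels has rank \<open>(t + 1) (m - 1) = n - d\<close> with \<open>d = t m + t + 1 > n / 3\<close>, whereas
  a nonzero element of \<open>J\<close> generates a subgroup of index at most \<open>max p m\<close>. Finally \<open>k\<close> is
  chosen so that \<open>n powr (\<epsilon> / 3) \<le> p \<le> n powr \<epsilon> / 4\<close>, which gives the bounds involving \<open>|J| = p + 1\<close>.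
\<close>

section \<open>Linear algebra: the rank bound for diagonal kernels\<close>

text \<open>Gaussian elimination, by induction on the equations: an equation with a nonzero
  coefficient at \<open>a\<close> is solved for the unknown at \<open>a\<close> and substituted into
  the others.\<close>

lemma underdetermined_homogeneous_system:
  fixes G :: "'s \<Rightarrow> 'a \<Rightarrow> 'k :: field"
  assumes "finite S" "finite A" "card S < card A"
  shows "\<exists>c. (\<exists>x\<in>A. c x \<noteq> 0) \<and> (\<forall>s\<in>S. (\<Sum>x\<in>A. c x * G s x) = 0)"
  using assms
proof (induction S arbitrary: A G rule: finite_induct)
  case empty
  then obtain a where "a \<in> A" by fastforce
  then show ?case by (intro exI[of _ "\<lambda>_. 1"]) auto
next
  case (insert s S)
  show ?case
  proof (cases "\<forall>x\<in>A. G s x = 0")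
    case True
    obtain c where "\<exists>x\<in>A. c x \<noteq> 0" "\<forall>u\<in>S. (\<Sum>x\<in>A. c x * G u x) = 0"
      using insert.IH[of A G] insert.prems insert.hyps by auto
    then show ?thesis using True by (intro exI[of _ c]) auto
  next
    case False
    then obtain a where a: "a \<in> A" "G s a \<noteq> 0" by blast
    define B where "B = A - {a}"
    have fB: "finite B" and AB: "A = insert a B" "a \<notin> B"
      using insert.prems a by (auto simp: B_def)
    have "card S < card B"
      using insert.prems insert.hyps a by (simp add: B_def)
    then obtain c where c: "\<exists>x\<in>B. c x \<noteq> 0"
        "\<forall>u\<in>S. (\<Sum>x\<in>B. c x * (G u x - G u a * G s x / G s a)) = 0"
      using insert.IH[OF fB, of "\<lambda>u x. G u x - G u a * G s x / G s a"] by blast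
    \<comment> \<open>The value at \<open>a\<close> is the one forced by equation \<open>s\<close>;
      the modified coefficients in the induction hypothesis then make the other equations
      hold.\<close>
    define e where "e = c(a := - (\<Sum>x\<in>B. c x * G s x) / G s a)"
    have sum_e: "(\<Sum>x\<in>A. e x * G u x) = (\<Sum>x\<in>B. c x * G u x) + e a * G u a" for u
    proof -
      have "(\<Sum>x\<in>B. e x * G u x) = (\<Sum>x\<in>B. c x * G u x)"
        using AB by (intro sum.cong) (auto simp: e_def)
      then show ?thesis using fB AB by (simp add: add.commute)
    qed
    have "(\<Sum>x\<in>A. e x * G u x) = 0" if "u \<in> insert s S" for u
    proof (cases "u = s")
      case True
      then show ?thesis using a by (simp add: sum_e) (simp add: e_def)
    next
      case False
      then have "0 = (\<Sum>x\<in>B. c x * (G u x - G u a * G s x / G s a))"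
        using that c by simp
      also have "\<dots> = (\<Sum>x\<in>B. c x * G u x - c x * G s x * (G u a / G s a))"
        by (intro sum.cong) (auto simp: algebra_simps)
      also have "\<dots> = (\<Sum>x\<in>B. c x * G u x) - (\<Sum>x\<in>B. c x * G s x) * (G u a / G s a)"
        by (simp add: sum_subtractf sum_distrib_right sum_divide_distrib)
      also have "\<dots> = (\<Sum>x\<in>A. e x * G u x)"
        by (simp add: sum_e) (simp add: e_def)
      finally show ?thesis by simp
    qed
    moreover have "\<exists>x\<in>A. e x \<noteq> 0"
      using c AB by (auto simp: e_def)
    ultimately show ?thesis by blast
  qed
qed

text \<open>The matrix factors through dimension \<open>card S\<close>. If \<open>A\<close> were
  larger, some nonzero vector would be killed by \<open>G\<close>, hence by the matrix, which is
  impossible for a diagonal matrix with nonzero diagonal.\<close>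

lemma card_le_if_diagonal_kernel:
  fixes F G :: "'s \<Rightarrow> 'a \<Rightarrow> 'k :: field"
  assumes "finite S" "finite A"
    and off: "\<And>x y. \<lbrakk>x \<in> A; y \<in> A; x \<noteq> y\<rbrakk> \<Longrightarrow> (\<Sum>s\<in>S. F s x * G s y) = 0"
    and diag: "\<And>x. x \<in> A \<Longrightarrow> (\<Sum>s\<in>S. F s x * G s x) \<noteq> 0"
  shows "card A \<le> card S"
proof (rule ccontr)
  assume "\<not> card A \<le> card S"
  then obtain c where c: "\<exists>x\<in>A. c x \<noteq> 0" "\<forall>s\<in>S. (\<Sum>y\<in>A. c y * G s y) = 0"
    using underdetermined_homogeneous_system[of S A G] assms by auto
  then obtain x where x: "x \<in> A" "c x \<noteq> 0" by blast
  have "0 = (\<Sum>s\<in>S. F s x * (\<Sum>y\<in>A. c y * G s y))"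
    using c by simp
  also have "\<dots> = (\<Sum>s\<in>S. \<Sum>y\<in>A. c y * (F s x * G s y))"
    by (simp add: sum_distrib_left mult_ac)
  also have "\<dots> = (\<Sum>y\<in>A. \<Sum>s\<in>S. c y * (F s x * G s y))"
    by (rule sum.swap)
  also have "\<dots> = (\<Sum>y\<in>A. c y * (\<Sum>s\<in>S. F s x * G s y))"
    by (simp add: sum_distrib_left)
  also have "\<dots> = (\<Sum>y\<in>{x}. c y * (\<Sum>s\<in>S. F s x * G s y))"
    using x off assms(2) by (intro sum.mono_neutral_right) auto
  also have "\<dots> \<noteq> 0"
    using x diag by simp
  finally show False by simp
qed

section \<open>Tensor powers and the bound on \<open>D\<close>\<close>

lemma D_le_power:
  fixes G (structure) and f :: "'a \<Rightarrow> 'k :: field"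
  assumes G: "group G" and fin: "finite (carrier G)" and J: "\<one> \<in> J" and "finite S"
    and supp: "\<And>x. x \<in> carrier G - J \<Longrightarrow> f x = 0" and f1: "f \<one> \<noteq> 0"
    and rank: "\<And>x y. \<lbrakk>x \<in> carrier G; y \<in> carrier G\<rbrakk> \<Longrightarrow> f (x \<otimes> inv y) = (\<Sum>s\<in>S. F s x * H s y)"
  shows "D G J N \<le> card S ^ N"
proof -
  interpret group G by (rule G)
  interpret P: group "power_group G N" by simp
  have fin_P: "finite (carrier (power_group G N))"
    using fin by (simp add: finite_PiE)
  have bound: "card A \<le> card S ^ N" if "difference_avoiding G J N A" for A
  proof -
    have A: "A \<subseteq> ({..<N} \<rightarrow>\<^sub>E carrier G)"
      and avoid: "(A <#>\<^bsub>power_group G N\<^esub> set_inv\<^bsub>power_group G N\<^esub> A) \<inter> ({..<N} \<rightarrow>\<^sub>E J)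
        = {\<one>\<^bsub>power_group G N\<^esub>}"
      using that by (auto simp: difference_avoiding_def)
    \<comment> \<open>Expanding a product of \<open>N\<close> sums over \<open>S\<close> indexes the
      terms by functions into \<open>S\<close>, so the tensor power factors through
      \<open>card S ^ N\<close> terms.\<close>
    have kernel: "(\<Sum>g\<in>{..<N} \<rightarrow>\<^sub>E S. (\<Prod>i<N. F (g i) (x i)) * (\<Prod>i<N. H (g i) (y i)))
        = (\<Prod>i<N. f (x i \<otimes> inv (y i)))" if "x \<in> A" "y \<in> A" for x y
    proof -
      have "(\<Prod>i<N. f (x i \<otimes> inv (y i))) = (\<Prod>i<N. \<Sum>s\<in>S. F s (x i) * H s (y i))"
        using A that by (intro prod.cong refl rank) (auto simp: PiE_iff)
      also have "\<dots> = (\<Sum>g\<in>{..<N} \<rightarrow>\<^sub>E S. \<Prod>i<N. F (g i) (x i) * H (g i) (y i))"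
        using \<open>finite S\<close> by (intro prod_sum_PiE) auto
      finally show ?thesis by (simp add: prod.distrib)
    qed
    have "card A \<le> card ({..<N} \<rightarrow>\<^sub>E S)"
    proof (rule card_le_if_diagonal_kernel[where F = "\<lambda>g x. \<Prod>i<N. F (g i) (x i)"
          and G = "\<lambda>g y. \<Prod>i<N. H (g i) (y i)"])
      show "finite ({..<N} \<rightarrow>\<^sub>E S)" using \<open>finite S\<close> by (simp add: finite_PiE)
      show "finite A" using A fin_P finite_subset by auto
    next
      fix x assume x: "x \<in> A"
      have "(\<Prod>i<N. f (x i \<otimes> inv (x i))) = (\<Prod>i<N. f \<one>)"
        using x A by (intro prod.cong refl) (auto simp: PiE_iff r_inv)
      then show "(\<Sum>g\<in>{..<N} \<rightarrow>\<^sub>E S. (\<Prod>i<N. F (g i) (x i)) * (\<Prod>i<N. H (g i) (x i))) \<noteq> 0"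
        using f1 by (simp add: kernel[OF x x])
    next
      fix x y assume xy: "x \<in> A" "y \<in> A" "x \<noteq> y"
      define z where "z = x \<otimes>\<^bsub>power_group G N\<^esub> inv\<^bsub>power_group G N\<^esub> y"
      have xP: "x \<in> carrier (power_group G N)" and yP: "y \<in> carrier (power_group G N)"
        using xy A by auto
      have zP: "z \<in> carrier (power_group G N)"
        unfolding z_def using xP yP by (intro P.m_closed P.inv_closed)
      \<comment> \<open>A nontrivial difference leaves \<open>J\<close> in some coordinate;
        \<open>f\<close> vanishes there and annihilates the whole product.\<close>
      have "z \<noteq> \<one>\<^bsub>power_group G N\<^esub>"
        unfolding z_def using P.inv_solve_right'[OF P.one_closed xP yP] xy(3) P.l_one[OF yP] by metis
      moreover have "z \<in> A <#>\<^bsub>power_group G N\<^esub> set_inv\<^bsub>power_group G N\<^esub> A"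
        using xy unfolding set_mult_def SET_INV_def z_def by blast
      ultimately have "z \<notin> {..<N} \<rightarrow>\<^sub>E J"
        using avoid by blast
      then obtain i where i: "i < N" "z i \<notin> J"
        using zP by (auto simp: PiE_iff)
      have zi: "z i = x i \<otimes> inv (y i)"
        using i xP yP by (simp add: z_def G)
      have "f (x i \<otimes> inv (y i)) = 0"
        using i zP supp unfolding zi[symmetric] by (auto simp: PiE_iff)
      then show "(\<Sum>g\<in>{..<N} \<rightarrow>\<^sub>E S. (\<Prod>i<N. F (g i) (x i)) * (\<Prod>i<N. H (g i) (y i))) = 0"
        using i by (auto simp: kernel[OF xy(1,2)])
    qed
    then show ?thesis by (simp add: card_PiE)
  qed
  \<comment> \<open>A bound on \<open>Max\<close> requires a nonempty finite set of sizes: the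
    trivial singleton gives nonemptiness, \<open>bound\<close> gives finiteness.\<close>
  have "difference_avoiding G J N {\<one>\<^bsub>power_group G N\<^esub>}"
    using J P.inv_one P.r_one[OF P.one_closed] P.one_closed
    unfolding difference_avoiding_def set_mult_def SET_INV_def by auto
  then have "{card A | A. difference_avoiding G J N A} \<noteq> {}" by blast
  moreover have "finite {card A | A. difference_avoiding G J N A}"
    by (rule finite_subset[of _ "{..card S ^ N}"]) (auto dest: bound)
  ultimately show ?thesis
    unfolding D_def by (subst Max_le_iff) (auto dest: bound)
qed

section \<open>Low-rank kernels on cyclic groups\<close>

text \<open>Functions live on \<open>int\<close>, with periodicity as a separate clause, so that
  kernels for two moduli can later be multiplied on the same integers.\<close>

lemma cyclic_interval_kernel:
  fixes m t :: nat
  assumes "t < m"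
  obtains f :: "int \<Rightarrow> complex" and F H :: "nat \<Rightarrow> int \<Rightarrow> complex" where
    "f 0 \<noteq> 0" "\<And>x. x mod int m > int t \<Longrightarrow> f x = 0"
    "\<And>x y. [x = y] (mod int m) \<Longrightarrow> f x = f y"
    "\<And>x y. f (x - y) = (\<Sum>i<m - t. F i x * H i y)"
proof -
  define e :: "int \<Rightarrow> complex" where "e x = cis (2 * pi * of_int x / of_nat m)" for x
  have e_diff: "e (x - y) = e x * e (- y)" for x y
    by (simp add: e_def cis_mult diff_divide_distrib algebra_simps)
  have e_eq_1: "e x = 1 \<longleftrightarrow> int m dvd x" for x
  proof -
    have "e x = 1 \<longleftrightarrow> cos (2 * pi * of_int x / of_nat m) = 1"
      by (auto simp: e_def complex_eq_iff cos_one_sin_zero)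
    also have "\<dots> \<longleftrightarrow> (\<exists>k::int. 2 * pi * of_int x / of_nat m = 2 * pi * of_int k)"
      by (simp add: cos_one_2pi_int mult_ac)
    also have "\<dots> \<longleftrightarrow> (\<exists>k::int. of_int x = (of_int (int m * k) :: real))"
      using assms by (intro ex_cong1) (auto simp: field_simps)
    also have "\<dots> \<longleftrightarrow> int m dvd x"
      unfolding of_int_eq_iff by (auto simp: dvd_def)
    finally show ?thesis .
  qed
  have e_eq: "e x = e y \<longleftrightarrow> [x = y] (mod int m)" for x y
  proof -
    have "e (x - y) * e y = e x"
      by (simp add: e_def cis_mult diff_divide_distrib algebra_simps)
    moreover have "e y \<noteq> 0" by (simp add: e_def)
    ultimately have "e x = e y \<longleftrightarrow> e (x - y) = 1" by auto
    then show ?thesis by (simp add: e_eq_1 cong_iff_dvd_diff)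
  qed
  \<comment> \<open>\<open>R\<close> has degree \<open>m - t - 1\<close>, hence \<open>m - t\<close>
    coefficients, and since \<open>e\<close> is a character each monomial in
    \<open>e (x - y)\<close> splits into a factor in \<open>x\<close> and a factor in
    \<open>y\<close>.\<close>
  define R where "R = (\<Prod>j\<in>{t<..<m}. [:- e (int j), 1:])"
  have "degree R = (\<Sum>j\<in>{t<..<m}. degree [:- e (int j), 1:])"
    unfolding R_def by (intro degree_prod_eq_sum_degree) auto
  then have "degree R = m - Suc t" by simp
  then have deg: "{..degree R} = {..<m - t}" using assms by auto
  have R: "poly R (e x) = (\<Prod>j\<in>{t<..<m}. e x - e (int j))" for x
    by (simp add: R_def poly_prod)
  show thesis
  proof (rule that)
    show "poly R (e 0) \<noteq> 0"
      using e_eq by (auto simp: R cong_def)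
    show "poly R (e x) = 0" if "x mod int m > int t" for x
    proof -
      have "nat (x mod int m) \<in> {t<..<m}" using that assms by (auto simp: nat_less_iff)
      moreover have "e x = e (int (nat (x mod int m)))"
        using assms by (simp add: e_eq cong_def)
      ultimately show ?thesis unfolding R
        by (intro prod_zero bexI[of _ "nat (x mod int m)"]) auto
    qed
    show "poly R (e x) = poly R (e y)" if "[x = y] (mod int m)" for x y
      using that e_eq[of x y] by simp
    show "poly R (e (x - y)) = (\<Sum>i<m - t. (poly.coeff R i * e x ^ i) * e (- y) ^ i)" for x y
      by (simp add: poly_altdef deg e_diff power_mult_distrib mult_ac)
  qed
qed

section \<open>Boxes of residues modulo \<open>p * m\<close>\<close>

text \<open>For coprime \<open>p\<close> and \<open>m\<close> this is the Chinese remainder preimage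
  of \<open>{0..s} \<times> {0..t}\<close>, written with the representatives used by
  \<open>integer_mod_group\<close>.\<close>

definition residue_box :: "nat \<Rightarrow> nat \<Rightarrow> nat \<Rightarrow> nat \<Rightarrow> int set" where
  "residue_box p m s t =
     {x \<in> {0..<int (p * m)}. x mod int p \<le> int s \<and> x mod int m \<le> int t}"

text \<open>The product of the interval kernels for \<open>p\<close> and \<open>m\<close> is
  supported on the box, and ranks multiply.\<close>

lemma D_residue_box_le:
  assumes "s < p" "t < m"
  shows "D (integer_mod_group (p * m)) (residue_box p m s t) N \<le> ((p - s) * (m - t)) ^ N"
proof -
  obtain f F H where f: "f 0 \<noteq> (0::complex)" "\<And>x. x mod int p > int s \<Longrightarrow> f x = 0"
    "\<And>x y. [x = y] (mod int p) \<Longrightarrow> f x = f y"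
    "\<And>x y. f (x - y) = (\<Sum>i<p - s. F i x * H i y)"
    using cyclic_interval_kernel[OF assms(1)] by blast
  obtain g K L where g: "g 0 \<noteq> (0::complex)" "\<And>x. x mod int m > int t \<Longrightarrow> g x = 0"
    "\<And>x y. [x = y] (mod int m) \<Longrightarrow> g x = g y"
    "\<And>x y. g (x - y) = (\<Sum>i<m - t. K i x * L i y)"
    using cyclic_interval_kernel[OF assms(2)] by blast
  have pos: "p > 0" "m > 0" using assms by auto
  let ?G = "integer_mod_group (p * m)"
  have "D ?G (residue_box p m s t) N \<le> card ({..<p - s} \<times> {..<m - t}) ^ N"
  proof (rule D_le_power[where f = "\<lambda>x. f x * g x"
        and F = "\<lambda>(i, j) x. F i x * K j x" and H = "\<lambda>(i, j) x. H i x * L j x"])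
    show "finite (carrier ?G)" using pos by (simp add: carrier_integer_mod_group)
    show "\<one>\<^bsub>?G\<^esub> \<in> residue_box p m s t" using pos by (simp add: residue_box_def)
    show "f x * g x = 0" if "x \<in> carrier ?G - residue_box p m s t" for x
      using that f(2) g(2) pos by (force simp: residue_box_def carrier_integer_mod_group)
    show "f \<one>\<^bsub>?G\<^esub> * g \<one>\<^bsub>?G\<^esub> \<noteq> 0" using f g by simp
    fix x y assume xy: "x \<in> carrier ?G" "y \<in> carrier ?G"
    define z where "z = x \<otimes>\<^bsub>?G\<^esub> inv\<^bsub>?G\<^esub> y"
    have z: "z = (x - y) mod int (p * m)"
      using xy by (simp add: z_def mod_add_right_eq)
    \<comment> \<open>Reduction modulo \<open>p * m\<close> preserves the residues modulo
      \<open>p\<close> and \<open>m\<close>.\<close>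
    have "f z = f (x - y)" "g z = g (x - y)"
      unfolding z by (rule f g; simp add: cong_def mod_mod_cancel)+
    then show "f z * g z = (\<Sum>s\<in>{..<p - s} \<times> {..<m - t}.
        (case s of (i, j) \<Rightarrow> \<lambda>x. F i x * K j x) x * (case s of (i, j) \<Rightarrow> \<lambda>x. H i x * L j x) y)"
      by (simp add: f(4) g(4) sum_product sum.cartesian_product case_prod_unfold mult_ac)
  qed auto
  then show ?thesis by (simp add: card_cartesian_product)
qed

text \<open>Injectivity is the Chinese remainder theorem; surjectivity follows by counting.\<close>

lemma bij_betw_residues:
  fixes p m :: nat
  assumes "coprime p m" "p > 0" "m > 0"
  shows "bij_betw (\<lambda>x. (x mod int p, x mod int m)) {0..<int (p * m)} ({0..<int p} \<times> {0..<int m})"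
proof -
  let ?f = "\<lambda>x. (x mod int p, x mod int m)"
  have inj: "inj_on ?f {0..<int (p * m)}"
  proof (rule inj_onI)
    fix x y assume xy: "x \<in> {0..<int (p * m)}" "y \<in> {0..<int (p * m)}" "?f x = ?f y"
    then have "[x = y] (mod int p * int m)"
      using assms by (intro coprime_cong_mult) (auto simp: cong_def)
    then show "x = y" using xy by (auto simp: cong_def)
  qed
  have sub: "?f ` {0..<int (p * m)} \<subseteq> {0..<int p} \<times> {0..<int m}"
    using assms by auto
  have "?f ` {0..<int (p * m)} = {0..<int p} \<times> {0..<int m}"
    by (rule card_subset_eq[OF _ sub])
       (simp_all only: card_image[OF inj] finite_cartesian_product finite_atLeastLessThan_int
          card_cartesian_product card_atLeastLessThan_int diff_zero nat_int)
  with inj show ?thesis by (simp add: bij_betw_def)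
qed

lemma card_residue_box:
  assumes "coprime p m" "s < p" "t < m"
  shows "card (residue_box p m s t) = (s + 1) * (t + 1)"
proof -
  let ?f = "\<lambda>x. (x mod int p, x mod int m)"
  have bij: "bij_betw ?f {0..<int (p * m)} ({0..<int p} \<times> {0..<int m})"
    using assms by (intro bij_betw_residues) auto
  have "bij_betw ?f (residue_box p m s t) ({0..int s} \<times> {0..int t})"
  proof (rule bij_betw_subset[OF bij])
    show "residue_box p m s t \<subseteq> {0..<int (p * m)}" by (auto simp: residue_box_def)
    show "?f ` residue_box p m s t = {0..int s} \<times> {0..int t}"
    proof
      show "?f ` residue_box p m s t \<subseteq> {0..int s} \<times> {0..int t}"
        using assms by (auto simp: residue_box_def)
      show "{0..int s} \<times> {0..int t} \<subseteq> ?f ` residue_box p m s t"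
      proof
        fix z assume z: "z \<in> {0..int s} \<times> {0..int t}"
        then have "z \<in> {0..<int p} \<times> {0..<int m}" using assms by auto
        then have "z \<in> ?f ` {0..<int (p * m)}"
          using bij_betw_imp_surj_on[OF bij] by simp
        then obtain x where "x \<in> {0..<int (p * m)}" "z = ?f x"
          by (rule imageE)
        then show "z \<in> ?f ` residue_box p m s t"
          using z by (auto simp: residue_box_def)
      qed
    qed
  qed
  then show ?thesis by (auto dest!: bij_betw_same_card simp: nat_add_distrib)
qed

text \<open>The residues of \<open>x\<close> and \<open>- x\<close> would otherwise add up to
  \<open>p\<close>, but their sum is at most \<open>2 * s\<close>.\<close>

lemma mod_eq_0_if_both_small:
  fixes x :: int
  assumes "x mod int p \<le> int s" "(- x) mod int p \<le> int s" "2 * s < p"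
  shows "int p dvd x"
proof (rule ccontr)
  assume "\<not> int p dvd x"
  then have "(- x) mod int p = int p - x mod int p"
    by (simp add: zmod_zminus1_eq_if dvd_eq_mod_eq_0)
  then show False using assms by linarith
qed

lemma residue_box_Int_set_inv:
  assumes "coprime p m" "2 * s < p" "2 * t < m"
  shows "residue_box p m s t \<inter> set_inv\<^bsub>integer_mod_group (p * m)\<^esub> (residue_box p m s t) = {0}"
proof -
  have pos: "p > 0" "m > 0" using assms by auto
  have sub: "residue_box p m s t \<subseteq> carrier (integer_mod_group (p * m))"
    using pos by (auto simp: residue_box_def carrier_integer_mod_group)
  have "x = 0" if x: "x \<in> residue_box p m s t" and y: "y \<in> residue_box p m s t"
    and eq: "x = inv\<^bsub>integer_mod_group (p * m)\<^esub> y" for x y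
  proof -
    have "x = (- y) mod int (p * m)" using y sub eq by auto
    then have "x mod int p = (- y) mod int p" "x mod int m = (- y) mod int m"
      by (simp_all add: mod_mod_cancel)
    then have "int p dvd y" "int m dvd y"
      using x y assms by (auto intro!: mod_eq_0_if_both_small simp: residue_box_def)
    then have "int (p * m) dvd y"
      using assms by (simp add: divides_mult)
    then show ?thesis using \<open>x = (- y) mod int (p * m)\<close> by simp
  qed
  moreover have "0 \<in> residue_box p m s t"
    using pos by (simp add: residue_box_def)
  moreover have "0 = inv\<^bsub>integer_mod_group (p * m)\<^esub> 0"
    by simp
  ultimately show ?thesis unfolding SET_INV_def by blast
qed

section \<open>Generators and subgroup indices\<close>

lemma generate_integer_mod_group_one:
  assumes "1 \<in> J" "J \<subseteq> carrier (integer_mod_group n)"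
  shows "generate (integer_mod_group n) J = carrier (integer_mod_group n)"
proof -
  interpret group "integer_mod_group n" by simp
  have "x \<in> generate (integer_mod_group n) {1}" if "x \<in> carrier (integer_mod_group n)" for x
  proof -
    have "1 \<in> carrier (integer_mod_group n)" using assms by auto
    moreover have "x = 1 [^]\<^bsub>integer_mod_group n\<^esub> x"
      using that by (auto simp: int_pow_integer_mod_group carrier_integer_mod_group split: if_splits)
    ultimately show ?thesis using generate_pow by blast
  qed
  moreover have "generate (integer_mod_group n) {1} \<subseteq> generate (integer_mod_group n) J"
    using assms by (intro mono_generate) auto
  ultimately show ?thesis using generate_incl[OF assms(2)] by blast
qed

lemma order_integer_mod_group:
  "n > 0 \<Longrightarrow> Coset.order (integer_mod_group n) = n"
  by (simp add: Coset.order_def carrier_integer_mod_group)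

text \<open>Since \<open>ord a * a\<close> is divisible by \<open>p\<close> and \<open>a\<close> is
  coprime to \<open>p\<close>, the order of the subgroup is a multiple of \<open>p\<close>; Lagrange
  bounds the index.\<close>

lemma subgroup_index_generate_le:
  assumes "a \<in> carrier (integer_mod_group (p * m))" "coprime a (int p)" "p > 0" "m > 0"
  shows "subgroup_index (integer_mod_group (p * m)) (generate (integer_mod_group (p * m)) {a}) \<le> m"
proof -
  let ?G = "integer_mod_group (p * m)"
  let ?H = "generate ?G {a}"
  interpret group ?G by simp
  have fin: "finite (carrier ?G)" using assms by (simp add: carrier_integer_mod_group)
  have sg: "subgroup ?H ?G" using assms by (intro generate_is_subgroup) auto
  have "a [^]\<^bsub>?G\<^esub> ord a = \<one>\<^bsub>?G\<^esub>" using assms by (intro pow_ord_eq_1)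
  then have "int (p * m) dvd int (ord a) * a" by (simp add: dvd_eq_mod_eq_0)
  then have "int p dvd int (ord a) * a" by (metis dvd_mult_left of_nat_mult)
  then have "p dvd ord a"
    using assms by (simp add: coprime_commute coprime_dvd_mult_left_iff)
  moreover have "ord a > 0" using fin assms ord_ge_1 by force
  ultimately have "p \<le> card ?H"
    using assms by (simp add: generate_pow_card[symmetric] dvd_imp_le)
  moreover have "subgroup_index ?G ?H * card ?H = p * m"
    using lagrange_finite[OF fin sg] order_integer_mod_group[of "p * m"] assms
    by (simp add: subgroup_index_def)
  ultimately have "subgroup_index ?G ?H * p \<le> m * p"
    by (metis mult.commute mult_le_mono2)
  then show ?thesis using assms by simp
qed

text \<open>The second side of the box is \<open>{0, 1}\<close> because \<open>m\<close> need not be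
  prime: a nonzero residue modulo \<open>m\<close> is then \<open>1\<close>, a unit. So
  \<open>a\<close> is coprime to \<open>p\<close> or to \<open>m\<close>.\<close>

lemma subgroup_index_residue_box_le:
  assumes "prime p" "\<not> p dvd m" "s < p" "1 < m" "a \<in> residue_box p m s 1" "a \<noteq> 0"
  shows "subgroup_index (integer_mod_group (p * m)) (generate (integer_mod_group (p * m)) {a}) \<le> max p m"
proof -
  have pos: "p > 0" "m > 0" using assms by auto
  have a: "a \<in> carrier (integer_mod_group (p * m))"
    using assms pos by (auto simp: residue_box_def carrier_integer_mod_group)
  show ?thesis
  proof (cases "int p dvd a")
    case False
    then have "coprime a (int p)"
      using assms prime_imp_coprime[of "int p" a] by (simp add: coprime_commute)
    then show ?thesis using subgroup_index_generate_le[OF a _ pos] by simp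
  next
    case True
    have "\<not> int m dvd a"
    proof
      assume "int m dvd a"
      then have "int (p * m) dvd a"
        using True assms by (simp add: divides_mult prime_imp_coprime)
      then show False
        using assms by (auto simp: residue_box_def dest: zdvd_imp_le)
    qed
    moreover have "0 \<le> a mod int m" "a mod int m \<le> 1"
      using assms pos by (simp_all add: residue_box_def)
    ultimately have "a mod int m = 1"
      unfolding dvd_eq_mod_eq_0 by linarith
    then have "coprime a (int m)"
      using coprime_mod_left_iff[of "int m" a] pos by simp
    then show ?thesis using subgroup_index_generate_le[of a m p] a pos by (simp add: mult.commute)
  qed
qed

section \<open>Choice of the parameters\<close>

lemma finite_set_of_large_primes:
  "\<exists>S. finite S \<and> card S = k \<and> (\<forall>q\<in>S. prime q \<and> q > (b::nat))"
proof -
  have "infinite ({q. prime q} - {..b})"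
    using primes_infinite by (intro Diff_infinite_finite) auto
  from infinite_arbitrarily_large[OF this, of k] obtain S
    where "finite S" "card S = k" "S \<subseteq> {q. prime q} - {..b}"
    by blast
  then show ?thesis by (intro exI[of _ S]) auto
qed

lemma power_in_interval:
  fixes U :: real and Q :: nat
  assumes "Q > 1" "real Q \<le> U"
  obtains k where "k > 0" "real Q ^ k \<le> U" "U < real Q ^ Suc k"
proof -
  have "eventually (\<lambda>k. U < real Q ^ k) sequentially"
    using filterlim_realpow_sequentially_gt1[of "real Q"] assms
    by (auto simp: filterlim_at_top_dense filterlim_at_infinity_conv_norm_at_top norm_power)
  then obtain j where j: "U < real Q ^ j" by (auto simp: eventually_at_top_linorder)
  \<comment> \<open>The wanted exponent is the predecessor of the first one that overshoots
    \<open>U\<close>; it is positive because \<open>Q\<close> itself does not overshoot.\<close>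
  define l where "l = (LEAST j. U < real Q ^ j)"
  have l: "U < real Q ^ l" unfolding l_def using j by (rule LeastI)
  obtain k where k: "l = Suc k" using l assms by (cases l) auto
  moreover have "k > 0" using l k assms by (cases k) auto
  moreover have "real Q ^ k \<le> U"
    using not_less_Least[of k "\<lambda>j. U < real Q ^ j"] k by (force simp: l_def[symmetric])
  ultimately show thesis using that l by auto
qed

text \<open>
  Here \<open>m\<close> is the largest power of \<open>Q\<close> with \<open>p m \<le> p powr (3 / \<epsilon>)\<close>.
\<close>

lemma size_parameters:
  fixes \<epsilon> p m Q :: real
  assumes "0 < \<epsilon>" "\<epsilon> < 3" "Q \<ge> 1" "p \<ge> 4" "p \<ge> 4 * Q powr \<epsilon>"
    and m: "m \<le> p powr (3 / \<epsilon> - 1)" "p powr (3 / \<epsilon> - 1) < Q * m"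
  shows "(p * m) powr (\<epsilon> / 3) \<le> p" "4 * p \<le> (p * m) powr \<epsilon>"
proof -
  have "0 < Q * m" using m(2) assms(4) by (smt (verit) powr_gt_zero)
  then have m0: "m > 0" using assms(3) by (simp add: zero_less_mult_iff)
  have p_split: "p * p powr (3 / \<epsilon> - 1) = p powr (3 / \<epsilon>)"
    using assms(4) powr_add[of p 1 "3 / \<epsilon> - 1"] by simp
  have "p * m \<le> p powr (3 / \<epsilon>)"
    using m(1) assms(4) by (simp flip: p_split)
  then have "(p * m) powr (\<epsilon> / 3) \<le> (p powr (3 / \<epsilon>)) powr (\<epsilon> / 3)"
    using assms m0 by (intro powr_mono2) auto
  also have "\<dots> = p" using assms by (simp add: powr_powr)
  finally show "(p * m) powr (\<epsilon> / 3) \<le> p" .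
  \<comment> \<open>Choosing \<open>m\<close> among the powers of \<open>Q\<close> loses at most a
    factor \<open>Q\<close>.\<close>
  have "p powr (3 / \<epsilon>) \<le> Q * (p * m)"
    using m(2) assms(4) by (simp add: mult.left_commute flip: p_split)
  then have "(p powr (3 / \<epsilon>)) powr \<epsilon> \<le> (Q * (p * m)) powr \<epsilon>"
    using assms by (intro powr_mono2) auto
  then have "p ^ 3 \<le> Q powr \<epsilon> * (p * m) powr \<epsilon>"
    using assms m0 by (simp add: powr_powr powr_mult)
  \<comment> \<open>One factor \<open>p\<close> absorbs both the loss
    \<open>Q powr \<epsilon>\<close> and the constant \<open>4\<close>.\<close>
  moreover have "Q powr \<epsilon> * (4 * p) \<le> p ^ 3"
  proof -
    have "4 * Q powr \<epsilon> * p \<le> p * (p * p)"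
      using assms by (intro mult_mono) (auto intro: order_trans[of p "1 * p"] mult_right_mono)
    then show ?thesis by (simp add: power3_eq_cube mult_ac)
  qed
  ultimately have "Q powr \<epsilon> * (4 * p) \<le> Q powr \<epsilon> * (p * m) powr \<epsilon>"
    by (rule order_trans[rotated])
  then show "4 * p \<le> (p * m) powr \<epsilon>"
    by (rule mult_left_le_imp_le) (use assms in simp)
qed

section \<open>Verification of the example and conclusion\<close>

lemma residue_box_properties:
  fixes \<epsilon> :: real and t m :: nat
  defines "p \<equiv> 2 * t + 1"
  defines "n \<equiv> p * m"
  defines "J \<equiv> residue_box p m t 1" and "d \<equiv> int (t * m + t + 1)"
  assumes p: "prime p" "\<not> p dvd m" and t: "t \<ge> 2" and m: "m \<ge> 3" and \<epsilon>: "0 < \<epsilon>"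
    and size: "real n powr (\<epsilon> / 3) \<le> real p" "4 * real p \<le> real n powr \<epsilon>"
  shows "J \<subseteq> carrier (integer_mod_group n)" (is ?sub)
    and "int (D (integer_mod_group n) J N) \<le> (int n - d) ^ N" (is ?D)
    and "J \<inter> set_inv\<^bsub>integer_mod_group n\<^esub> J = {\<one>\<^bsub>integer_mod_group n\<^esub>}" (is ?inv)
    and "real (card J) \<ge> real n powr (\<epsilon> / 3)" (is ?card)
    and "generate (integer_mod_group n) J = carrier (integer_mod_group n)" (is ?gen)
    and "real_of_int d \<ge> 1 / 8 * real n powr (1 - \<epsilon> / 3)" (is ?d1)
    and "real_of_int d \<ge> real n powr (1 - \<epsilon>) * real (card J)" (is ?d2)
    and "\<forall>a \<in> J - {\<one>\<^bsub>integer_mod_group n\<^esub>}.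
       real (subgroup_index (integer_mod_group n) (generate (integer_mod_group n) {a}))
         \<le> real_of_int d - 1 / 24 * real n powr (1 - \<epsilon> / 3)" (is ?index)
proof -
  have n: "n > 0" and small: "t < p" "1 < m" "2 * t < p" "2 * 1 < m"
    using t m by (auto simp: n_def p_def)
  have cop: "coprime p m" using p by (simp add: prime_imp_coprime)
  show ?sub using n by (auto simp: J_def residue_box_def carrier_integer_mod_group n_def)
  have "int (D (integer_mod_group n) J N) \<le> int (p - t) ^ N * int (m - 1) ^ N"
    using D_residue_box_le[OF small(1,2), of N]
    unfolding J_def n_def of_nat_mult[symmetric] of_nat_power[symmetric] power_mult_distrib
    by (rule of_nat_mono)
  also have "\<dots> = ((int t + 1) * (int m - 1)) ^ N"
    using m by (simp add: p_def of_nat_diff power_mult_distrib add.commute)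
  \<comment> \<open>This identity dictates \<open>d\<close>: \<open>n - d\<close> is the rank of the
    kernel, with \<open>p - t = t + 1\<close>.\<close>
  also have "(int t + 1) * (int m - 1) = int n - d"
    by (simp add: n_def d_def p_def algebra_simps)
  finally show ?D .
  show ?inv
    using residue_box_Int_set_inv[OF cop small(3,4)] by (simp add: J_def n_def)
  have card_J: "card J = p + 1"
    using card_residue_box[OF cop small(1,2)] by (simp add: J_def p_def)
  then show ?card using size by simp
  have "2 * 3 \<le> p * m" using t m unfolding p_def by (intro mult_mono) auto
  moreover have "1 mod int p \<le> 1"
    by (rule zmod_le_nonneg_dividend) simp
  ultimately have "1 \<in> J" using small t by (simp add: J_def residue_box_def flip: of_nat_mult)
  then show ?gen using \<open>?sub\<close> by (rule generate_integer_mod_group_one)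
  \<comment> \<open>With this, the bounds with constants 1/8 and 1/24 follow from bounds linear in
    \<open>n\<close>.\<close>
  have n_le: "real n powr (1 - \<epsilon> / 3) \<le> real n"
    using powr_mono[of "1 - \<epsilon> / 3" 1 "real n"] n \<epsilon> by simp
  have n_le_d: "real n \<le> 3 * real_of_int d"
    unfolding n_def d_def p_def using t mult_right_mono[of 1 "real t" "real m"]
    by (simp add: algebra_simps)
  show ?d1 using n_le n_le_d by simp
  \<comment> \<open>The constant \<open>4\<close> in \<open>size\<close> is used here:
    \<open>3 * (p + 1) \<le> 4 * p\<close>. The \<open>3\<close> matches
    \<open>n_le_d\<close>.\<close>
  have "real n powr (1 - \<epsilon>) * (3 * real (card J)) \<le> real n powr (1 - \<epsilon>) * real n powr \<epsilon>"
    using size(2) t by (intro mult_left_mono) (simp_all add: card_J, simp add: p_def)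
  also have "\<dots> = real n" using n by (simp flip: powr_add)
  finally show ?d2 using n_le_d by simp
  show ?index
  proof
    fix a assume a: "a \<in> J - {\<one>\<^bsub>integer_mod_group n\<^esub>}"
    have "subgroup_index (integer_mod_group n) (generate (integer_mod_group n) {a}) \<le> max p m"
      using a subgroup_index_residue_box_le[OF p small(1,2)]
      by (simp add: J_def n_def)
    then have "real (subgroup_index (integer_mod_group n) (generate (integer_mod_group n) {a}))
        \<le> max (real p) (real m)"
      by (simp flip: of_nat_max)
    also have "\<dots> \<le> real_of_int d - 1 / 24 * real n"
    proof -
      \<comment> \<open>These two inequalities make the comparisons with \<open>p\<close> and
        \<open>m\<close> linear in \<open>t * m\<close>, \<open>t\<close> and
        \<open>m\<close>.\<close>
      have "2 * real m \<le> real t * real m" "real t * 3 \<le> real t * real m"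
        using t m by (auto intro!: mult_right_mono mult_left_mono)
      moreover have "real n = 2 * (real t * real m) + real m"
        "real_of_int d = real t * real m + real t + 1" "real p = 2 * real t + 1"
        by (simp_all add: n_def d_def p_def algebra_simps)
      ultimately show ?thesis unfolding max.bounded_iff by linarith
    qed
    also have "\<dots> \<le> real_of_int d - 1 / 24 * real n powr (1 - \<epsilon> / 3)"
      using n_le by simp
    finally show "real (subgroup_index (integer_mod_group n) (generate (integer_mod_group n) {a}))
         \<le> real_of_int d - 1 / 24 * real n powr (1 - \<epsilon> / 3)" .
  qed
qed

text \<open>The bound \<open>\<epsilon> < 3\<close> is forced: for \<open>\<epsilon> \<ge> 3\<close>
  the size condition gives \<open>card J \<ge> n\<close>, so \<open>J\<close> is the whole group,
  contradicting the condition on \<open>J\<close> and its inverse as \<open>n > 1\<close>.\<close>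

theorem theorem1p8:
  fixes \<epsilon> M :: real
  assumes "\<epsilon> > 0" and "\<epsilon> < 3" and "M > 0"
  shows "infinite {n :: nat. n > 0 \<and> (\<exists>(J :: int set) (d :: int).
    J \<subseteq> carrier (integer_mod_group n) \<and>
    (\<forall>N::nat. N > 0 \<longrightarrow> int (D (integer_mod_group n) J N) \<le> (int n - d) ^ N) \<and>
    real (card (prime_factors n)) \<ge> M \<and>
    real (Min (prime_factors n)) \<ge> M \<and>
    J \<inter> set_inv\<^bsub>integer_mod_group n\<^esub> J = {\<one>\<^bsub>integer_mod_group n\<^esub>} \<and>
    real (card J) \<ge> real n powr (\<epsilon> / 3) \<and>
    generate (integer_mod_group n) J = carrier (integer_mod_group n) \<and>
    real_of_int d \<ge> 1 / 8 * real n powr (1 - \<epsilon> / 3) \<and>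
    real_of_int d \<ge> real n powr (1 - \<epsilon>) * real (card J) \<and>
    (\<forall>a \<in> J - {\<one>\<^bsub>integer_mod_group n\<^esub>}.
       real (subgroup_index (integer_mod_group n) (generate (integer_mod_group n) {a}))
         \<le> real_of_int d - 1 / 24 * real n powr (1 - \<epsilon> / 3)))}"
    (is "infinite ?X")
  unfolding infinite_nat_iff_unbounded
proof
  fix b :: nat
  obtain K :: nat where K: "M \<le> real K" "K > 0"
    using real_arch_simple[of M] assms(3) by (metis gr0I not_le of_nat_0)
  \<comment> \<open>Taking \<open>K\<close> primes above \<open>K\<close> serves both the number and
    the size of the prime divisors; excluding 2 yields \<open>Q \<ge> 3\<close>.\<close>
  obtain S where S: "finite S" "card S = K" "\<And>q. q \<in> S \<Longrightarrow> prime q \<and> q > max 2 K"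
    using finite_set_of_large_primes by metis
  define Q where "Q = \<Prod>S"
  have Q_pos: "Q > 0" unfolding Q_def using S by (intro prod_pos) (metis gr0I not_prime_0)
  obtain q where q: "q \<in> S" using S K by fastforce
  then have "q dvd Q" using S by (auto simp: Q_def)
  then have "q \<le> Q" using Q_pos by (rule dvd_imp_le)
  then have Q3: "Q \<ge> 3" using S(3)[OF q] by simp
  define c where "c = 3 / \<epsilon> - 1"
  \<comment> \<open>The summands serve in turn: \<open>4\<close> and
    \<open>4 * Q powr \<epsilon>\<close> for \<open>size_parameters\<close>,
    \<open>Q powr (1 / c)\<close> for \<open>Q \<le> U\<close>, \<open>Q\<close> for
    \<open>p\<close> not dividing \<open>Q\<close>, \<open>b\<close> for unboundedness, and
    \<open>K\<close> for the smallest prime divisor.\<close>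
  define x where "x = 4 + 4 * real Q powr \<epsilon> + real Q powr (1 / c) + real Q + real b + real K"
  obtain p where p: "prime p" "p > nat \<lceil>x\<rceil>"
    using bigger_prime by blast
  then have "real p > x" by linarith
  then have px: "real p > 4" "real p > 4 * real Q powr \<epsilon>" "real p > real Q powr (1 / c)"
    "p > Q" "p > b" "p > K"
    using powr_ge_zero[of "real Q" \<epsilon>] powr_ge_zero[of "real Q" "1 / c"]
    unfolding x_def by linarith+
  define U where "U = real p powr c"
  have "c > 0" using assms by (simp add: c_def field_simps)
  then have "real Q = (real Q powr (1 / c)) powr c"
    using Q_pos by (simp add: powr_powr)
  also have "\<dots> \<le> U"
    unfolding U_def using px \<open>c > 0\<close> by (intro powr_mono2) auto
  finally have "real Q \<le> U" .
  then obtain k where k: "k > 0" "real Q ^ k \<le> U" "U < real Q ^ Suc k"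
    using power_in_interval[of Q U] Q3 by auto
  define m where "m = Q ^ k"
  define t where "t = p div 2"
  have "odd p" using p px by (auto simp: prime_odd_nat)
  then have pt: "p = 2 * t + 1" by (simp add: t_def)
  have t2: "t \<ge> 2" using px pt by simp
  have "\<not> p dvd Q" using px Q_pos dvd_imp_le by fastforce
  then have pm: "\<not> p dvd m" using p by (auto simp: m_def dest: prime_dvd_power)
  have "Q ^ 1 \<le> Q ^ k" using k Q3 by (intro power_increasing) auto
  then have m3: "m \<ge> 3" using Q3 by (simp add: m_def)
  have size: "real (p * m) powr (\<epsilon> / 3) \<le> real p" "4 * real p \<le> real (p * m) powr \<epsilon>"
    using size_parameters[of \<epsilon> "real Q" "real p" "real m"] assms px Q3 k
    by (auto simp: m_def U_def c_def)
  note example = residue_box_properties[of t m \<epsilon>, folded pt, OF p(1) pm t2 m3 assms(1) size]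
  have S_prime: "prime r" if "r \<in> S" for r
    using S(3) that by blast
  have dvd_Q: "r dvd Q \<longleftrightarrow> r \<in> S" if "prime r" for r
  proof -
    have "r dvd Q \<longleftrightarrow> (\<exists>q\<in>S. r dvd q)"
      using that S(1) by (simp add: Q_def prime_dvd_prod_iff)
    also have "\<dots> \<longleftrightarrow> r \<in> S"
      using that S_prime by (metis dvd_refl primes_dvd_imp_eq)
    finally show ?thesis .
  qed
  \<comment> \<open>Positivity of \<open>k\<close> matters: only then do \<open>Q ^ k\<close> and
    \<open>Q\<close> have the same prime divisors.\<close>
  have "r \<in> prime_factors (p * m) \<longleftrightarrow> r \<in> insert p S" for r
  proof (cases "prime r")
    case True
    then have "r dvd p * m \<longleftrightarrow> r = p \<or> r \<in> S"
      using p(1) k(1) dvd_Q[OF True] primes_dvd_imp_eq[of r p]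
      by (auto simp: m_def prime_dvd_mult_iff prime_dvd_power_iff)
    then show ?thesis
      using True px(1) m3 by (simp add: in_prime_factors_iff)
  next
    case False
    then show ?thesis using p(1) S by (auto simp: in_prime_factors_iff)
  qed
  then have factors: "prime_factors (p * m) = insert p S" by blast
  have "p \<notin> S" using \<open>\<not> p dvd Q\<close> dvd_Q p(1) by blast
  then have card_factors: "real (card (prime_factors (p * m))) \<ge> M"
    using K S by (simp add: factors)
  have "Min (insert p S) \<in> insert p S" using S by (intro Min_in) auto
  then have "Min (insert p S) \<ge> K" using S(3)[of "Min (insert p S)"] px by auto
  then have Min_factors: "real (Min (prime_factors (p * m))) \<ge> M"
    using K by (simp add: factors)
  have "p * 1 \<le> p * m" using m3 by (intro mult_le_mono2) auto
  then have "p * m > b" using px by linarith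
  moreover have "p * m \<in> ?X"
    using m3 px by (intro CollectI conjI exI[of _ "residue_box p m t 1"]
      exI[of _ "int (t * m + t + 1)"] allI impI example card_factors Min_factors) auto
  ultimately show "\<exists>n>b. n \<in> ?X" by blast
qed

end
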